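(* Let $A$ be the adjacency matrix of a digraph with self-loops $D_S$ of order $n$ with vertex set $V$, $\sigma$ self-loops, and $c_2$ as defined in the context. Let $\rho(A)$ be the spectral radius of $A$. Then $$\rho(A)\ge\frac{c_2+\sigma}{n}.$$ Equality holds if and only if $D_S=\overleftrightarrow{G_S}+\{\text{some arcs that do not belong to cycles}\}$ (i.e. $D_S$ is obtained from $\overleftrightarrow{G_S}$ by adding a possibly empty set of arcs not belonging to any cycle of $D_S$), where $G_S$ is a $\left(\frac{c_2+\sigma}{n},\frac{c_2+\sigma}{n}+1\right)$-bidegreed graph with self-loops such that $$\deg_{G_S}(v)=\begin{cases}\frac{c_2+\sigma}{n}+1,&v\in S,\\ \frac{c_2+\sigma}{n},&v\in V\setminus S.\end{cases}$$
   Context: A digraph with self-loops $D_S$ is a pair $(V,\mathcal A)$ with $V$ a nonempty finite vertex set and $\mathcal A\subseteq V\times V$ a set of arcs; $S=\{v\in V:(v,v)\in\mathcal A\}$ is the self-loop set (possibly empty). The order is $n=|V|$ and $\sigma=|S|$. The number $c_2$ is the number of closed walks $vwv$ with $v\ne w$, i.e. the number of ordered pairs $(v,w)$ with $v\neq w$ and $(v,w),(w,v)\in\mathcal A$. The adjacency matrix $(a_{ij})$ has $a_{ij}=1$ if $(v_i,v_j)\in\mathcal A$ and $0$ otherwise. Cycles are directed cycles; a self-loop is a cycle of length $1$. A graph with self-loops $G_S=(V,\mathcal E,S)$ is a finite simple undirected graph $(V,\mathcal E)$ with one self-loop attached at each vertex of $S\subseteq V$. Each self-loop contributes $2$ to the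 degree: if $A(G_S)=(a_{ij})$ is the symmetric $(0,1)$ adjacency matrix (with diagonal entry $1$ exactly at vertices of $S$), then $\deg_{G_S}(v_i)=\sum_j a_{ij}+1$ if $v_i\in S$ and $\deg_{G_S}(v_i)=\sum_ja_{ij}$ otherwise. $G_S$ is $(a,b)$-bidegreed if every vertex has degree $a$ or $b$. The symmetrization $\overleftrightarrow{G_S}$ is the digraph on the same vertex set in which each edge $vw$ ($v\ne w$) is replaced by the two arcs $(v,w),(w,v)$ and each undirected loop by a directed loop. *)

theory Defs
  imports
    "Jordan_Normal_Form.Spectral_Radius"
    "Graph_Theory.Pair_Digraph"
begin

text \<open>
  Digraphs with self-loops are the \<open>pair_pre_digraph\<close> records of \<open>Graph_Theory\<close> satisfying
  \<open>pair_fin_digraph\<close>: at most one arc per ordered pair of vertices, loops allowed.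
\<close>

definition loop_verts :: "'a pair_pre_digraph \<Rightarrow> 'a set" where
  "loop_verts D = {v \<in> pverts D. (v, v) \<in> parcs D}"

definition c2 :: "'a pair_pre_digraph \<Rightarrow> nat" where
  "c2 D = card {(v, w). v \<noteq> w \<and> (v, w) \<in> parcs D \<and> (w, v) \<in> parcs D}"

text \<open>
  The list \<open>vs\<close> enumerates the vertices. The entries are complex because \<open>spectral_radius\<close> is
  the maximal modulus over the complex eigenvalues.
\<close>

definition adj_matrix :: "'a pair_pre_digraph \<Rightarrow> 'a list \<Rightarrow> complex mat" where
  "adj_matrix D vs = mat (length vs) (length vs)
     (\<lambda>(i, j). if (vs ! i, vs ! j) \<in> parcs D then 1 else 0)"

text \<open>
  \<open>pre_digraph.cycle\<close> allows cycles of length one, so a loop lies on a cycle, and so do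
  both arcs of an opposite pair.
\<close>

definition on_cycle :: "'a pair_pre_digraph \<Rightarrow> 'a \<times> 'a \<Rightarrow> bool" where
  "on_cycle D e \<longleftrightarrow> (\<exists>p. pre_digraph.cycle (with_proj D) p \<and> e \<in> set p)"

record 'a loop_graph =
  lverts :: "'a set"
  ledges :: "'a set set"
  lloops :: "'a set"

definition wf_loop_graph :: "'a loop_graph \<Rightarrow> bool" where
  "wf_loop_graph G \<longleftrightarrow> finite (lverts G) \<and>
     ledges G \<subseteq> {{v, w} | v w. v \<in> lverts G \<and> w \<in> lverts G \<and> v \<noteq> w} \<and>
     lloops G \<subseteq> lverts G"

definition loop_graph_adj :: "'a loop_graph \<Rightarrow> 'a \<Rightarrow> 'a \<Rightarrow> nat" where
  "loop_graph_adj G v w =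
     (if v \<noteq> w \<and> {v, w} \<in> ledges G \<or> v = w \<and> v \<in> lloops G then 1 else 0)"

text \<open>A loop contributes 2 to the degree: 1 from the diagonal entry and 1 from the extra summand.\<close>

definition loop_graph_deg :: "'a loop_graph \<Rightarrow> 'a \<Rightarrow> nat" where
  "loop_graph_deg G v =
     (\<Sum>w\<in>lverts G. loop_graph_adj G v w) + (if v \<in> lloops G then 1 else 0)"

definition bidegreed :: "real \<Rightarrow> real \<Rightarrow> 'a loop_graph \<Rightarrow> bool" where
  "bidegreed a b G \<longleftrightarrow>
     (\<forall>v\<in>lverts G. real (loop_graph_deg G v) = a \<or> real (loop_graph_deg G v) = b)"

definition symmetrization :: "'a loop_graph \<Rightarrow> 'a pair_pre_digraph" where
  "symmetrization G = \<lparr> pverts = lverts G,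
     parcs = {(v, w). v \<noteq> w \<and> {v, w} \<in> ledges G} \<union> {(v, v) | v. v \<in> lloops G} \<rparr>"

definition plus_arcs :: "'a pair_pre_digraph \<Rightarrow> ('a \<times> 'a) set \<Rightarrow> 'a pair_pre_digraph" where
  "plus_arcs D X = \<lparr> pverts = pverts D, parcs = parcs D \<union> X \<rparr>"

end

theory Submission
  imports Defs
begin

text \<open>
  Powers of a matrix grow no faster than any rate above its spectral radius, so lower bounds on
  numbers of walks bound the spectral radius from below. Let \<open>B\<close> be the symmetric part of the
  adjacency matrix \<open>A\<close>, which keeps loops and opposite pairs of arcs. The Cauchy-Schwarz inequality
  shows that the walk counts of \<open>B\<close> along exponents \<open>2 ^ p\<close> grow at least like the powers of the
  average row sum \<open>k = (c2 + \<sigma>) / n\<close>, and strictly faster unless all row sums are equal to \<open>k\<close>;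
  and \<open>A\<close> dominates \<open>B\<close>. If all row sums of \<open>B\<close> are \<open>k\<close>, an arc of a cycle without opposite arc
  gives a surplus in its strongly connected component, which spreads over the component and
  forces a growth rate above \<open>k\<close>. Without such arcs every strongly connected component is
  bidirected and \<open>k\<close>-regular, hence no eigenvalue exceeds \<open>k\<close> in modulus.
\<close>

section \<open>Real kernels on the vertex set and the eigenvalues of their matrices\<close>

text \<open>For a 0/1 kernel the \<open>m\<close>-th iterate applied to the constant 1 gives, at
  \<open>v\<close>, the number of walks of length \<open>m\<close> starting in
  \<open>v\<close>.\<close>

definition kernel_op :: "'a set \<Rightarrow> ('a \<Rightarrow> 'a \<Rightarrow> real) \<Rightarrow> ('a \<Rightarrow> real) \<Rightarrow> 'a \<Rightarrow> real" where
  "kernel_op V a f v = (\<Sum>w\<in>V. a v w * f w)"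

definition kernel_mat :: "'a list \<Rightarrow> ('a \<Rightarrow> 'a \<Rightarrow> real) \<Rightarrow> complex mat" where
  "kernel_mat vs a = mat (length vs) (length vs) (\<lambda>(i, j). complex_of_real (a (vs ! i) (vs ! j)))"

lemma kernel_mat_carrier [simp]: "kernel_mat vs a \<in> carrier_mat (length vs) (length vs)"
  by (simp add: kernel_mat_def)

lemma sum_nth_distinct:
  assumes "distinct vs"
  shows "(\<Sum>i<length vs. f (vs ! i)) = sum f (set vs)"
  by (rule sum.reindex_bij_betw[OF bij_betw_nth[OF assms refl refl]])

lemma kernel_mat_mult_vec:
  assumes "distinct vs" and i: "i < length vs"
  shows "(kernel_mat vs a *\<^sub>v vec (length vs) (\<lambda>j. x (vs ! j))) $ i
    = (\<Sum>w\<in>set vs. complex_of_real (a (vs ! i) w) * x w)"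
proof -
  have "(kernel_mat vs a *\<^sub>v vec (length vs) (\<lambda>j. x (vs ! j))) $ i
    = (\<Sum>j<length vs. complex_of_real (a (vs ! i) (vs ! j)) * x (vs ! j))"
    using i by (simp add: kernel_mat_def scalar_prod_def lessThan_atLeast0)
  also have "\<dots> = (\<Sum>w\<in>set vs. complex_of_real (a (vs ! i) w) * x w)"
    by (rule sum_nth_distinct[OF assms(1)])
  finally show ?thesis .
qed

text \<open>Replaces index vectors by functions on vertices, so that scaling, shifting and the
  analysis of supports need no positions in \<open>vs\<close>.\<close>

lemma eigenvalue_kernel_mat_iff:
  assumes "distinct vs"
  shows "eigenvalue (kernel_mat vs a) \<mu> \<longleftrightarrow>
    (\<exists>x. (\<exists>v\<in>set vs. x v \<noteq> 0) \<and>
      (\<forall>v\<in>set vs. (\<Sum>w\<in>set vs. complex_of_real (a v w) * x w) = \<mu> * x v))"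
    (is "_ \<longleftrightarrow> ?R")
proof
  let ?n = "length vs"
  have dim: "dim_row (kernel_mat vs a) = ?n" by (simp add: kernel_mat_def)
  {
    assume "eigenvalue (kernel_mat vs a) \<mu>"
    then obtain z where z: "z \<in> carrier_vec ?n" "z \<noteq> 0\<^sub>v ?n"
      "kernel_mat vs a *\<^sub>v z = \<mu> \<cdot>\<^sub>v z"
      unfolding eigenvalue_def eigenvector_def dim by auto
    \<comment> \<open>Pulls \<open>z\<close> back along the enumeration. Distinctness makes the
      index unique; values off \<open>set vs\<close> never matter.\<close>
    define x where "x v = z $ (THE i. i < ?n \<and> vs ! i = v)" for v
    have x: "x (vs ! i) = z $ i" if "i < ?n" for i
    proof -
      have "(THE j. j < ?n \<and> vs ! j = vs ! i) = i"
        using that assms by (auto simp: nth_eq_iff_index_eq)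
      then show ?thesis by (simp add: x_def)
    qed
    have zx: "z = vec ?n (\<lambda>j. x (vs ! j))"
      using z(1) x by (intro eq_vecI) auto
    have "\<exists>v\<in>set vs. x v \<noteq> 0"
    proof (rule ccontr)
      assume "\<not> ?thesis"
      then have "z = 0\<^sub>v ?n" by (subst zx, intro eq_vecI) auto
      with z(2) show False by simp
    qed
    moreover have "(\<Sum>w\<in>set vs. complex_of_real (a v w) * x w) = \<mu> * x v" if "v \<in> set vs" for v
    proof -
      from that obtain i where i: "i < ?n" "v = vs ! i" by (auto simp: in_set_conv_nth)
      have "(kernel_mat vs a *\<^sub>v z) $ i = (\<mu> \<cdot>\<^sub>v z) $ i" using z(3) by simp
      then show ?thesis
        using kernel_mat_mult_vec[OF assms i(1), of a x] z(1) i x by (simp flip: zx)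
    qed
    ultimately show ?R by blast
  }
  {
    assume ?R
    then obtain x v where v: "v \<in> set vs" "x v \<noteq> 0"
      and x: "\<And>v. v \<in> set vs \<Longrightarrow> (\<Sum>w\<in>set vs. complex_of_real (a v w) * x w) = \<mu> * x v" by blast
    from v(1) obtain i where i: "i < ?n" "v = vs ! i" by (auto simp: in_set_conv_nth)
    let ?z = "vec ?n (\<lambda>j. x (vs ! j))"
    have "?z $ i \<noteq> 0\<^sub>v ?n $ i" using i v by simp
    then have "?z \<noteq> 0\<^sub>v ?n" by metis
    moreover have "kernel_mat vs a *\<^sub>v ?z = \<mu> \<cdot>\<^sub>v ?z"
    proof (rule eq_vecI)
      fix j assume j: "j < dim_vec (\<mu> \<cdot>\<^sub>v ?z)"
      then have jn: "j < ?n" by simp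
      show "(kernel_mat vs a *\<^sub>v ?z) $ j = (\<mu> \<cdot>\<^sub>v ?z) $ j"
        unfolding kernel_mat_mult_vec[OF assms jn] using x[of "vs ! j"] jn by simp
    qed (simp add: dim)
    ultimately have "eigenvector (kernel_mat vs a) ?z \<mu>"
      unfolding eigenvector_def dim by simp
    then show "eigenvalue (kernel_mat vs a) \<mu>" by (auto simp: eigenvalue_def)
  }
qed

lemma spectral_radius_kernel_mat_ge:
  assumes "eigenvalue (kernel_mat vs a) \<mu>"
  shows "norm \<mu> \<le> spectral_radius (kernel_mat vs a)"
  using spectral_radius_mem_max(2)[OF kernel_mat_carrier eigenvalue_imp_nonzero_dim[OF kernel_mat_carrier assms]] assms
  by (simp add: spectrum_def)

lemma spectral_radius_kernel_mat_attained:
  assumes "vs \<noteq> []"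
  obtains \<mu> where "eigenvalue (kernel_mat vs a) \<mu>" "norm \<mu> = spectral_radius (kernel_mat vs a)"
  using spectral_radius_mem_max(1)[OF kernel_mat_carrier, of vs a] assms
  by (auto simp: spectrum_def)

lemma spectral_radius_kernel_mat_nonneg:
  assumes "vs \<noteq> []"
  shows "0 \<le> spectral_radius (kernel_mat vs a)"
  by (rule spectral_radius_kernel_mat_attained[OF assms, of a]) (metis norm_ge_zero)

text \<open>An eigenvalue of largest modulus, divided by \<open>c\<close>, is an eigenvalue of
  \<open>a\<close> with the same eigenvector.\<close>

lemma spectral_radius_kernel_mat_scale:
  assumes "distinct vs" "vs \<noteq> []" "c > 0"
  shows "spectral_radius (kernel_mat vs (\<lambda>v w. c * a v w)) \<le> c * spectral_radius (kernel_mat vs a)"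
proof -
  let ?ca = "\<lambda>v w. c * a v w"
  obtain \<mu> where \<mu>: "eigenvalue (kernel_mat vs ?ca) \<mu>"
    "norm \<mu> = spectral_radius (kernel_mat vs ?ca)"
    using spectral_radius_kernel_mat_attained[OF assms(2)] .
  from \<mu>(1) obtain x where x: "\<exists>v\<in>set vs. x v \<noteq> 0"
      "\<forall>v\<in>set vs. (\<Sum>w\<in>set vs. complex_of_real (?ca v w) * x w) = \<mu> * x v"
    unfolding eigenvalue_kernel_mat_iff[OF assms(1)] by blast
  have "(\<Sum>w\<in>set vs. complex_of_real (a v w) * x w) = (\<mu> / c) * x v" if "v \<in> set vs" for v
  proof -
    have "c * (\<Sum>w\<in>set vs. complex_of_real (a v w) * x w) = \<mu> * x v"
      using bspec[OF x(2) that] by (simp add: sum_distrib_left mult.assoc)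
    then show ?thesis using assms(3) by (simp add: field_simps)
  qed
  then have "eigenvalue (kernel_mat vs a) (\<mu> / c)"
    unfolding eigenvalue_kernel_mat_iff[OF assms(1)] using x(1) by blast
  from spectral_radius_kernel_mat_ge[OF this] show ?thesis
    using \<mu>(2) assms(3) by (simp add: norm_divide field_simps)
qed

text \<open>Adding the identity keeps eigenvectors and moves eigenvalues by 1, so the triangle
  inequality suffices.\<close>

lemma spectral_radius_kernel_mat_shift:
  assumes "distinct vs" "vs \<noteq> []"
  shows "spectral_radius (kernel_mat vs (\<lambda>v w. a v w + of_bool (v = w)))
    \<le> spectral_radius (kernel_mat vs a) + 1"
proof -
  let ?a1 = "\<lambda>v w. a v w + of_bool (v = w)"
  obtain \<mu> where \<mu>: "eigenvalue (kernel_mat vs ?a1) \<mu>"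
    "norm \<mu> = spectral_radius (kernel_mat vs ?a1)"
    using spectral_radius_kernel_mat_attained[OF assms(2)] .
  from \<mu>(1) obtain x where x: "\<exists>v\<in>set vs. x v \<noteq> 0"
      "\<forall>v\<in>set vs. (\<Sum>w\<in>set vs. complex_of_real (?a1 v w) * x w) = \<mu> * x v"
    unfolding eigenvalue_kernel_mat_iff[OF assms(1)] by blast
  have "(\<Sum>w\<in>set vs. complex_of_real (a v w) * x w) = (\<mu> - 1) * x v" if v: "v \<in> set vs" for v
  proof -
    have "(\<Sum>w\<in>set vs. complex_of_real (?a1 v w) * x w)
      = (\<Sum>w\<in>set vs. complex_of_real (a v w) * x w + (if v = w then x w else 0))"
      by (rule sum.cong) (auto simp: algebra_simps)
    also have "\<dots> = (\<Sum>w\<in>set vs. complex_of_real (a v w) * x w) + x v"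
      using v by (simp add: sum.distrib)
    finally show ?thesis using bspec[OF x(2) v] by (simp only: left_diff_distrib mult_1_left) simp
  qed
  then have "eigenvalue (kernel_mat vs a) (\<mu> - 1)"
    unfolding eigenvalue_kernel_mat_iff[OF assms(1)] using x(1) by blast
  from spectral_radius_kernel_mat_ge[OF this] show ?thesis
    using \<mu>(2) norm_triangle_sub[of \<mu> 1] by simp
qed

section \<open>Iterates of a kernel and their growth rate\<close>

lemma kernel_mat_pow_mult_vec:
  assumes "distinct vs"
  shows "(kernel_mat vs a ^\<^sub>m m) *\<^sub>v vec (length vs) (\<lambda>j. complex_of_real (f (vs ! j)))
    = vec (length vs) (\<lambda>j. complex_of_real ((kernel_op (set vs) a ^^ m) f (vs ! j)))"
proof (induction m arbitrary: f)
  case 0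
  show ?case by (simp add: kernel_mat_def)
next
  case (Suc m)
  let ?n = "length vs"
  let ?vec = "\<lambda>g. vec ?n (\<lambda>j. complex_of_real (g (vs ! j)))"
  have "(kernel_mat vs a ^\<^sub>m Suc m) *\<^sub>v ?vec f = (kernel_mat vs a ^\<^sub>m m) *\<^sub>v (kernel_mat vs a *\<^sub>v ?vec f)"
    by (simp add: assoc_mult_mat_vec[where ?n\<^sub>1.0 = ?n and ?n\<^sub>2.0 = ?n and ?n\<^sub>3.0 = ?n] pow_carrier_mat)
  also have "kernel_mat vs a *\<^sub>v ?vec f = ?vec (kernel_op (set vs) a f)"
  proof (rule eq_vecI)
    fix i assume "i < dim_vec (?vec (kernel_op (set vs) a f))"
    then have i: "i < ?n" by simp
    show "(kernel_mat vs a *\<^sub>v ?vec f) $ i = ?vec (kernel_op (set vs) a f) $ i"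
      unfolding kernel_mat_mult_vec[OF assms i, of a "\<lambda>v. complex_of_real (f v)"]
      using i by (simp add: kernel_op_def)
  qed (simp add: kernel_mat_def)
  finally show ?case by (simp add: Suc.IH funpow_swap1)
qed

text \<open>Below spectral radius 1 one constant bounds all entries of all powers, hence all
  iterates of a fixed function.\<close>

lemma kernel_op_pow_bounded:
  assumes "distinct vs" and "spectral_radius (kernel_mat vs a) < 1"
  obtains C where "\<And>m. \<bar>\<Sum>v\<in>set vs. (kernel_op (set vs) a ^^ m) f v\<bar> \<le> C"
proof -
  let ?n = "length vs" and ?A = "kernel_mat vs a"
  from spectral_radius_jnf_norm_bound_less_1_upper_triangular[OF kernel_mat_carrier assms(2)]
  obtain c where c: "\<And>k. norm_bound (?A ^\<^sub>m k) c" by auto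
  have bound: "\<bar>(kernel_op (set vs) a ^^ m) f (vs ! i)\<bar> \<le> c * (\<Sum>v\<in>set vs. \<bar>f v\<bar>)" if i: "i < ?n" for m i
  proof -
    have car: "?A ^\<^sub>m m \<in> carrier_mat ?n ?n" by (simp add: pow_carrier_mat)
    have "complex_of_real ((kernel_op (set vs) a ^^ m) f (vs ! i))
      = (?A ^\<^sub>m m *\<^sub>v vec ?n (\<lambda>j. complex_of_real (f (vs ! j)))) $ i"
      using i by (simp add: kernel_mat_pow_mult_vec[OF assms(1)])
    also have "\<dots> = (\<Sum>j<?n. (?A ^\<^sub>m m) $$ (i, j) * complex_of_real (f (vs ! j)))"
      using i carrier_matD[OF car]
      by (subst index_mult_mat_vec) (simp_all add: scalar_prod_def lessThan_atLeast0)
    finally have "\<bar>(kernel_op (set vs) a ^^ m) f (vs ! i)\<bar>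
      = norm (\<Sum>j<?n. (?A ^\<^sub>m m) $$ (i, j) * complex_of_real (f (vs ! j)))"
      by (metis norm_of_real)
    also have "\<dots> \<le> (\<Sum>j<?n. c * \<bar>f (vs ! j)\<bar>)"
    proof (rule sum_norm_le)
      fix j assume "j \<in> {..<?n}"
      then have "norm ((?A ^\<^sub>m m) $$ (i, j)) \<le> c"
        using c[of m] i carrier_matD[OF car] unfolding norm_bound_def by auto
      then show "norm ((?A ^\<^sub>m m) $$ (i, j) * complex_of_real (f (vs ! j))) \<le> c * \<bar>f (vs ! j)\<bar>"
        by (simp add: norm_mult mult_right_mono)
    qed
    also have "\<dots> = c * (\<Sum>v\<in>set vs. \<bar>f v\<bar>)"
      by (simp add: sum_nth_distinct[OF assms(1), of "\<lambda>v. \<bar>f v\<bar>"] flip: sum_distrib_left)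
    finally show ?thesis .
  qed
  have "\<bar>\<Sum>v\<in>set vs. (kernel_op (set vs) a ^^ m) f v\<bar> \<le> (\<Sum>v\<in>set vs. c * (\<Sum>v\<in>set vs. \<bar>f v\<bar>))" for m
    by (rule order.trans[OF sum_abs], rule sum_mono) (metis bound in_set_conv_nth)
  then show ?thesis using that by blast
qed

lemma kernel_op_pow_scale:
  "(kernel_op V (\<lambda>v w. c * a v w) ^^ m) f v = c ^ m * (kernel_op V a ^^ m) f v"
proof (induction m arbitrary: v)
  case (Suc m)
  show ?case
    unfolding funpow.simps o_apply kernel_op_def[of V _ _ v] Suc.IH
    by (simp add: sum_distrib_left mult.assoc mult.left_commute)
qed simp

text \<open>If \<open>c\<close> exceeded the spectral radius, dividing \<open>a\<close> by some
  \<open>s\<close> strictly between them would make the iterates bounded, although they grow like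
  \<open>(c / s) ^ m\<close>. Growth is asked only for arbitrarily large exponents, since it will be
  known only along special sequences.\<close>

lemma spectral_radius_ge_growth:
  assumes "distinct vs" "vs \<noteq> []" "K > 0" "c \<ge> 0"
    and growth: "\<And>N. \<exists>m\<ge>N. K * c ^ m \<le> (\<Sum>v\<in>set vs. (kernel_op (set vs) a ^^ m) f v)"
  shows "c \<le> spectral_radius (kernel_mat vs a)"
proof (rule ccontr)
  let ?\<rho> = "spectral_radius (kernel_mat vs a)"
  assume "\<not> c \<le> ?\<rho>"
  then have "?\<rho> < c" by simp
  then obtain s where s: "?\<rho> < s" "s < c" using dense by blast
  have \<rho>0: "?\<rho> \<ge> 0" by (rule spectral_radius_kernel_mat_nonneg[OF assms(2)])
  with s have s0: "s > 0" by simp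
  let ?b = "\<lambda>v w. (1 / s) * a v w"
  have "spectral_radius (kernel_mat vs ?b) \<le> (1 / s) * ?\<rho>"
    using s0 by (intro spectral_radius_kernel_mat_scale[OF assms(1,2)]) simp
  also have "\<dots> < 1" using s0 s by simp
  finally obtain C where C: "\<And>m. \<bar>\<Sum>v\<in>set vs. (kernel_op (set vs) ?b ^^ m) f v\<bar> \<le> C"
    using kernel_op_pow_bounded[OF assms(1)] by metis
  have "1 < c / s" using s s0 by simp
  then obtain N where N: "C / K < (c / s) ^ N" using real_arch_pow by blast
  obtain m where m: "m \<ge> N" "K * c ^ m \<le> (\<Sum>v\<in>set vs. (kernel_op (set vs) a ^^ m) f v)"
    using growth by blast
  have "C / K < (c / s) ^ m"
    using N power_increasing[OF m(1), of "c / s"] \<open>1 < c / s\<close> by linarith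
  then have "C < (1 / s) ^ m * (K * c ^ m)" using \<open>K > 0\<close> by (simp add: field_simps)
  also have "\<dots> \<le> (1 / s) ^ m * (\<Sum>v\<in>set vs. (kernel_op (set vs) a ^^ m) f v)"
    using m(2) s0 by (intro mult_left_mono) auto
  also have "\<dots> = (\<Sum>v\<in>set vs. (kernel_op (set vs) ?b ^^ m) f v)"
    unfolding kernel_op_pow_scale by (simp add: sum_distrib_left)
  also have "\<dots> \<le> C" using C[of m] by linarith
  finally show False by simp
qed

text \<open>Both claims share one induction, because multiplying the inequalities needs the smaller
  iterate to be nonnegative.\<close>

lemma kernel_op_pow_mono:
  assumes "\<And>v w. v \<in> V \<Longrightarrow> w \<in> V \<Longrightarrow> 0 \<le> b v w" "\<And>v w. v \<in> V \<Longrightarrow> w \<in> V \<Longrightarrow> b v w \<le> a v w"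
    and "\<And>v. v \<in> V \<Longrightarrow> 0 \<le> g v" "\<And>v. v \<in> V \<Longrightarrow> g v \<le> f v" and "v \<in> V"
  shows "0 \<le> (kernel_op V b ^^ m) g v \<and> (kernel_op V b ^^ m) g v \<le> (kernel_op V a ^^ m) f v"
  using assms(5)
proof (induction m arbitrary: v)
  case (Suc m)
  show ?case
    unfolding funpow.simps o_apply kernel_op_def[of V _ _ v]
  proof
    show "0 \<le> (\<Sum>w\<in>V. b v w * (kernel_op V b ^^ m) g w)"
      using Suc assms(1) by (intro sum_nonneg mult_nonneg_nonneg) auto
    show "(\<Sum>w\<in>V. b v w * (kernel_op V b ^^ m) g w) \<le> (\<Sum>w\<in>V. a v w * (kernel_op V a ^^ m) f w)"
    proof (intro sum_mono mult_mono)
      fix w assume "w \<in> V"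
      show "0 \<le> a v w" using assms(1,2)[OF Suc.prems \<open>w \<in> V\<close>] by linarith
    qed (use Suc assms(1,2) in auto)
  qed
qed (use assms in auto)

lemma kernel_op_pow_linear:
  "(kernel_op V a ^^ m) (\<lambda>v. c * f v + g v) v = c * (kernel_op V a ^^ m) f v + (kernel_op V a ^^ m) g v"
proof (induction m arbitrary: v)
  case (Suc m)
  show ?case
    unfolding funpow.simps o_apply kernel_op_def[of V _ _ v] Suc.IH
    by (simp add: sum_distrib_left sum.distrib distrib_left mult.left_commute)
qed simp

lemma kernel_op_pow_zero: "(kernel_op V a ^^ m) (\<lambda>v. 0) v = 0"
  by (induction m arbitrary: v) (simp_all add: kernel_op_def)

text \<open>A block of \<open>m\<close> steps dominates multiplication by \<open>c\<close>;
  linearity and monotonicity let such blocks be composed.\<close>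

lemma kernel_op_pow_supereigen:
  assumes a: "\<And>v w. v \<in> V \<Longrightarrow> w \<in> V \<Longrightarrow> 0 \<le> a v w"
    and y: "\<And>v. v \<in> V \<Longrightarrow> 0 \<le> y v" and c: "c \<ge> 0"
    and super: "\<And>v. v \<in> V \<Longrightarrow> c * y v \<le> (kernel_op V a ^^ m) y v" and "v \<in> V"
  shows "c ^ p * y v \<le> (kernel_op V a ^^ (m * p)) y v"
  using \<open>v \<in> V\<close>
proof (induction p arbitrary: v)
  case (Suc p)
  have "c ^ Suc p * y v \<le> c ^ p * (kernel_op V a ^^ m) y v"
    using mult_left_mono[OF super[OF Suc.prems], of "c ^ p"] c by (simp add: mult_ac)
  also have "\<dots> = (kernel_op V a ^^ m) (\<lambda>v. c ^ p * y v) v"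
    using kernel_op_pow_linear[of m V a "c ^ p" y "\<lambda>_. 0" v] by (simp add: kernel_op_pow_zero)
  also have "\<dots> \<le> (kernel_op V a ^^ m) ((kernel_op V a ^^ (m * p)) y) v"
    by (rule conjunct2[OF kernel_op_pow_mono]) (use Suc a y c in auto)
  also have "\<dots> = (kernel_op V a ^^ (m * Suc p)) y v"
    by (simp add: funpow_add)
  finally show ?case .
qed simp

section \<open>Symmetric kernels below a given kernel\<close>

text \<open>By symmetry each application of the kernel moves from one factor to the other;
  \<open>f\<close> is general in the induction because it absorbs them.\<close>

lemma kernel_op_pow_self_adjoint:
  assumes "\<And>v w. v \<in> V \<Longrightarrow> w \<in> V \<Longrightarrow> b v w = b w v"
  shows "(\<Sum>v\<in>V. f v * (kernel_op V b ^^ m) g v) = (\<Sum>v\<in>V. (kernel_op V b ^^ m) f v * g v)"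
proof (induction m arbitrary: f)
  case (Suc m)
  have "(\<Sum>v\<in>V. f v * (kernel_op V b ^^ Suc m) g v)
    = (\<Sum>v\<in>V. \<Sum>w\<in>V. f v * (b v w * (kernel_op V b ^^ m) g w))"
    by (simp add: kernel_op_def[of V b _] sum_distrib_left)
  also have "\<dots> = (\<Sum>w\<in>V. \<Sum>v\<in>V. f v * (b v w * (kernel_op V b ^^ m) g w))"
    by (rule sum.swap)
  also have "\<dots> = (\<Sum>w\<in>V. kernel_op V b f w * (kernel_op V b ^^ m) g w)"
    unfolding kernel_op_def[of V b f] sum_distrib_right
    by (intro sum.cong refl) (simp add: assms mult_ac)
  also have "\<dots> = (\<Sum>v\<in>V. (kernel_op V b ^^ m) (kernel_op V b f) v * g v)" by (rule Suc.IH)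
  finally show ?case by (simp add: funpow_swap1)
qed simp

text \<open>
  For symmetric \<open>b\<close>, walks of length \<open>2 m\<close> are counted by the squared norm of the vector counting
  walks of length \<open>m\<close>, so a lower bound on their number survives doubling \<open>m\<close>.
\<close>

lemma sum_kernel_op_pow_double:
  assumes sym: "\<And>v w. v \<in> V \<Longrightarrow> w \<in> V \<Longrightarrow> b v w = b w v" and c: "c \<ge> 0"
    and le: "c ^ m * real (card V) \<le> (\<Sum>v\<in>V. (kernel_op V b ^^ m) (\<lambda>_. 1) v)"
  shows "c ^ (m * 2 ^ p) * real (card V) \<le> (\<Sum>v\<in>V. (kernel_op V b ^^ (m * 2 ^ p)) (\<lambda>_. 1) v)"
proof (induction p)
  case (Suc p)
  let ?M = "m * 2 ^ p" and ?n = "real (card V)"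
  let ?g = "(kernel_op V b ^^ ?M) (\<lambda>_. 1)" and ?d = "c ^ (m * 2 ^ p)"
  \<comment> \<open>Cauchy-Schwarz in the form of a nonnegative sum of squared deviations from
    \<open>?d\<close>, the value that the induction hypothesis guarantees on average.\<close>
  have "0 \<le> (\<Sum>v\<in>V. (?g v - ?d)\<^sup>2)" by (intro sum_nonneg) simp
  also have "\<dots> = (\<Sum>v\<in>V. ?g v * ?g v) - 2 * ?d * (\<Sum>v\<in>V. ?g v) + ?d * ?d * ?n"
    by (simp add: power2_eq_square algebra_simps sum.distrib sum_subtractf sum_distrib_left)
  finally have "2 * (?d * (\<Sum>v\<in>V. ?g v)) - ?d * ?d * ?n \<le> (\<Sum>v\<in>V. ?g v * ?g v)" by simp
  moreover have "?d * (?d * ?n) \<le> ?d * (\<Sum>v\<in>V. ?g v)"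
    using Suc.IH c by (intro mult_left_mono) auto
  ultimately have "?d * ?d * ?n \<le> (\<Sum>v\<in>V. ?g v * ?g v)" by simp
  also have "\<dots> = (\<Sum>v\<in>V. (kernel_op V b ^^ (?M + ?M)) (\<lambda>_. 1) v)"
    using kernel_op_pow_self_adjoint[OF sym, where V = V and f = "\<lambda>_. 1" and m = ?M and g = ?g] by (simp add: funpow_add)
  finally show ?case by (simp add: power_add mult_2 distrib_left)
qed (use le in simp)

text \<open>Doubling carries the bound at \<open>m\<close> to the unbounded exponents
  \<open>m * 2 ^ p\<close>, and the larger kernel \<open>a\<close> inherits the growth.\<close>

lemma spectral_radius_ge_symmetric_minorant:
  assumes vs: "distinct vs" "vs \<noteq> []"
    and sym: "\<And>v w. v \<in> set vs \<Longrightarrow> w \<in> set vs \<Longrightarrow> b v w = b w v"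
    and nonneg: "\<And>v w. v \<in> set vs \<Longrightarrow> w \<in> set vs \<Longrightarrow> 0 \<le> b v w"
    and le: "\<And>v w. v \<in> set vs \<Longrightarrow> w \<in> set vs \<Longrightarrow> b v w \<le> a v w"
    and "c \<ge> 0" "m > 0"
    and walks: "c ^ m * real (card (set vs)) \<le> (\<Sum>v\<in>set vs. (kernel_op (set vs) b ^^ m) (\<lambda>_. 1) v)"
  shows "c \<le> spectral_radius (kernel_mat vs a)"
proof (rule spectral_radius_ge_growth[OF vs _ \<open>c \<ge> 0\<close>])
  show "0 < real (card (set vs))" using vs(2) by (simp add: card_gt_0_iff)
  fix N
  let ?M = "m * 2 ^ N"
  have "N \<le> 2 ^ N" using less_exp[of N] by simp
  also have "\<dots> \<le> ?M" using \<open>m > 0\<close> by simp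
  finally have "N \<le> ?M" .
  moreover have "real (card (set vs)) * c ^ ?M
    \<le> (\<Sum>v\<in>set vs. (kernel_op (set vs) b ^^ ?M) (\<lambda>_. 1) v)"
    using sum_kernel_op_pow_double[OF sym \<open>c \<ge> 0\<close> walks, of N] by (simp add: mult.commute)
  moreover have "\<dots> \<le> (\<Sum>v\<in>set vs. (kernel_op (set vs) a ^^ ?M) (\<lambda>_. 1) v)"
    by (intro sum_mono conjunct2[OF kernel_op_pow_mono]) (use nonneg le in auto)
  ultimately show "\<exists>M\<ge>N. real (card (set vs)) * c ^ M
      \<le> (\<Sum>v\<in>set vs. (kernel_op (set vs) a ^^ M) (\<lambda>_. 1) v)"
    by (meson order.trans)
qed

text \<open>Walks of length 2 are counted by the squared row sums of \<open>b\<close>, so the root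
  mean square of the row sums bounds the spectral radius from below. If that is at most the mean
  \<open>k\<close>, the variance of the row sums vanishes.\<close>

lemma symmetric_minorant_row_sums_const:
  assumes vs: "distinct vs" "vs \<noteq> []"
    and sym: "\<And>v w. v \<in> set vs \<Longrightarrow> w \<in> set vs \<Longrightarrow> b v w = b w v"
    and nonneg: "\<And>v w. v \<in> set vs \<Longrightarrow> w \<in> set vs \<Longrightarrow> 0 \<le> b v w"
    and le: "\<And>v w. v \<in> set vs \<Longrightarrow> w \<in> set vs \<Longrightarrow> b v w \<le> a v w"
    and total: "(\<Sum>v\<in>set vs. \<Sum>w\<in>set vs. b v w) = k * real (card (set vs))"
    and rho: "spectral_radius (kernel_mat vs a) \<le> k" and v: "v \<in> set vs"
  shows "(\<Sum>w\<in>set vs. b v w) = k"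
proof -
  let ?V = "set vs" and ?n = "real (card (set vs))"
  let ?r = "\<lambda>v. \<Sum>w\<in>?V. b v w"
  let ?W = "\<Sum>v\<in>?V. (?r v)\<^sup>2"
  have n: "?n > 0" using vs(2) by (simp add: card_gt_0_iff)
  have r: "kernel_op ?V b (\<lambda>_. 1) = ?r" by (simp add: kernel_op_def fun_eq_iff)
  have W: "(\<Sum>v\<in>?V. (kernel_op ?V b ^^ 2) (\<lambda>_. 1) v) = ?W"
    using kernel_op_pow_self_adjoint[OF sym, where V = ?V and f = "\<lambda>_. 1" and m = 1 and g = ?r]
    by (simp add: numeral_2_eq_2 r power2_eq_square)
  have "sqrt (?W / ?n) \<le> spectral_radius (kernel_mat vs a)"
  proof (rule spectral_radius_ge_symmetric_minorant[OF vs sym nonneg le, where m = 2])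
    show "sqrt (?W / ?n) ^ 2 * ?n \<le> (\<Sum>v\<in>?V. (kernel_op ?V b ^^ 2) (\<lambda>_. 1) v)"
      unfolding W using n by (simp add: sum_nonneg)
  qed (auto simp: sum_nonneg)
  with rho have le: "sqrt (?W / ?n) \<le> k" by simp
  moreover have "0 \<le> sqrt (?W / ?n)" by (simp add: sum_nonneg)
  ultimately have "(sqrt (?W / ?n))\<^sup>2 \<le> k\<^sup>2" by (intro power_mono)
  then have "?W \<le> k\<^sup>2 * ?n" using n by (simp add: sum_nonneg field_simps)
  moreover have "(\<Sum>v\<in>?V. (?r v - k)\<^sup>2) = ?W - 2 * k * (\<Sum>v\<in>?V. ?r v) + k\<^sup>2 * ?n"
    by (simp add: power2_diff sum.distrib sum_subtractf sum_distrib_left mult_ac)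
  ultimately have "(\<Sum>v\<in>?V. (?r v - k)\<^sup>2) \<le> 0" by (simp add: total power2_eq_square)
  then have "(\<Sum>v\<in>?V. (?r v - k)\<^sup>2) = 0" by (intro antisym sum_nonneg) auto
  then show ?thesis using v by (simp add: sum_nonneg_eq_0_iff)
qed

section \<open>Surplus in a strongly connected set of vertices\<close>

text \<open>
  The argument runs with \<open>a\<close> plus the identity: then iterates are monotone in the exponent, so the
  surplus at \<open>u\<close> reaches all of \<open>C\<close> at one common time, and \<open>k = 0\<close> needs no special treatment.
\<close>

lemma spectral_radius_gt_strongly_connected:
  assumes vs: "distinct vs" and C: "C \<subseteq> set vs" "u \<in> C" and "k \<ge> 0"
    and a: "\<And>v w. v \<in> set vs \<Longrightarrow> w \<in> set vs \<Longrightarrow> 0 \<le> a v w"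
    and row: "\<And>v. v \<in> C \<Longrightarrow> k \<le> (\<Sum>w\<in>C. a v w)"
    and row_u: "k + 1 \<le> (\<Sum>w\<in>C. a u w)"
    and reach: "\<And>v. v \<in> C \<Longrightarrow> (v, u) \<in> {(x, y). x \<in> set vs \<and> y \<in> set vs \<and> 1 \<le> a x y}\<^sup>*"
  shows "k < spectral_radius (kernel_mat vs a)"
proof -
  let ?V = "set vs" and ?s = "\<lambda>v w. a v w + of_bool (v = w)"
  let ?S = "kernel_op (set vs) ?s"
  \<comment> \<open>One step of \<open>?S\<close> multiplies the indicator \<open>?y\<close> of
    \<open>C\<close> by at least \<open>k + 1\<close>; \<open>?e\<close> records the extra unit
    gained at \<open>u\<close>.\<close>
  let ?y = "\<lambda>v. of_bool (v \<in> C) :: real" and ?e = "\<lambda>v. of_bool (v = u) :: real"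
  have ne: "vs \<noteq> []" and u: "u \<in> ?V" and fin: "finite C" using C finite_subset by auto
  have s: "0 \<le> ?s v w" if "v \<in> ?V" "w \<in> ?V" for v w using a[OF that] by simp
  note mono = conjunct2[OF kernel_op_pow_mono[where V = ?V and a = ?s and b = ?s]]
  note nonneg = conjunct1[OF kernel_op_pow_mono[where V = ?V and a = ?s and b = ?s]]
  have S: "?S f v = (\<Sum>w\<in>?V. a v w * f w) + f v" if "v \<in> ?V" for f v
  proof -
    have "?S f v = (\<Sum>w\<in>?V. a v w * f w + (if v = w then f w else 0))"
      unfolding kernel_op_def by (intro sum.cong) (auto simp: algebra_simps)
    then show ?thesis using that by (simp add: sum.distrib)
  qed
  have Sy: "(\<Sum>w\<in>?V. a v w * ?y w) = (\<Sum>w\<in>C. a v w)" for v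
    using C(1) by (simp add: of_bool_def if_distrib sum.If_cases Int_absorb1 cong: if_cong)
  have step: "(k + 1) * ?y v + ?e v \<le> (?S ^^ 1) ?y v" if v: "v \<in> ?V" for v
  proof (cases "v \<in> C")
    case True
    then show ?thesis using row[OF True] row_u v by (cases "v = u") (auto simp: S Sy)
  next
    case False
    have "0 \<le> (\<Sum>w\<in>C. a v w)" using a v C(1) by (intro sum_nonneg) auto
    then show ?thesis using False v C(2) by (auto simp: S Sy)
  qed
  have e_nonneg: "0 \<le> (?S ^^ m) ?e v" if "v \<in> ?V" for m v
    by (rule nonneg) (use s that in auto)
  have e_mono: "(?S ^^ m) ?e v \<le> (?S ^^ (m + l)) ?e v" if "v \<in> ?V" for m l v
  proof (induction l)
    case (Suc l)
    have "0 \<le> (\<Sum>w\<in>?V. a v w * (?S ^^ (m + l)) ?e w)"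
      using a that e_nonneg by (intro sum_nonneg mult_nonneg_nonneg) auto
    then show ?case using Suc by (simp add: S that)
  qed simp
  \<comment> \<open>The surplus travels backwards along a path from \<open>v\<close> to
    \<open>u\<close>, whose arcs have weight at least 1.\<close>
  have "\<exists>m. 1 \<le> (?S ^^ m) ?e v" if "v \<in> C" for v
    using reach[OF that]
  proof (induction rule: converse_rtrancl_induct)
    case base
    show ?case by (rule exI[of _ 0]) simp
  next
    case (step x z)
    then obtain m where m: "1 \<le> (?S ^^ m) ?e z" by blast
    have xz: "x \<in> ?V" "z \<in> ?V" "1 \<le> a x z" using step(1) by auto
    have "1 * 1 \<le> a x z * (?S ^^ m) ?e z" by (rule mult_mono) (use xz m a in auto)
    also have "\<dots> \<le> (\<Sum>w\<in>?V. a x w * (?S ^^ m) ?e w)"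
      by (rule member_le_sum) (use xz a e_nonneg in auto)
    also have "\<dots> \<le> (?S ^^ Suc m) ?e x" using e_nonneg[OF xz(1)] xz(1) by (simp add: S)
    finally show ?case by (intro exI[of _ "Suc m"]) simp
  qed
  then obtain h where h: "\<And>v. v \<in> C \<Longrightarrow> 1 \<le> (?S ^^ h v) ?e v" by metis
  \<comment> \<open>A crude common upper bound for all arrival times \<open>h v\<close>.\<close>
  define N where "N = sum h C"
  have hN: "1 \<le> (?S ^^ N) ?e v" if "v \<in> C" for v
  proof -
    have "h v \<le> N" unfolding N_def using that fin by (intro member_le_sum) auto
    then show ?thesis using e_mono[of v "h v" "N - h v"] h[OF that] that C(1) by auto
  qed
  \<comment> \<open>The first step leaves a surplus \<open>?e\<close>, which \<open>N\<close>
    further steps raise to at least 1 on all of \<open>C\<close>. So \<open>Suc N\<close> steps gain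
    one more than the factor \<open>(k + 1) ^ Suc N\<close>.\<close>
  define d where "d = (k + 1) ^ Suc N + 1"
  have d: "d * ?y v \<le> (?S ^^ Suc N) ?y v" if v: "v \<in> ?V" for v
  proof -
    have "(k + 1) ^ N * ?y v \<le> (?S ^^ (1 * N)) ?y v"
    proof (rule kernel_op_pow_supereigen[OF s])
      fix v assume "v \<in> ?V"
      then show "(k + 1) * ?y v \<le> (?S ^^ 1) ?y v" using step[of v] by (simp add: of_bool_def split: if_splits)
    qed (use \<open>k \<ge> 0\<close> v in auto)
    then have "(k + 1) * ((k + 1) ^ N * ?y v) \<le> (k + 1) * (?S ^^ N) ?y v"
      using \<open>k \<ge> 0\<close> by (intro mult_left_mono) auto
    moreover have "?y v \<le> (?S ^^ N) ?e v" using hN[of v] e_nonneg[OF v] by (cases "v \<in> C") auto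
    ultimately have "d * ?y v \<le> (k + 1) * (?S ^^ N) ?y v + (?S ^^ N) ?e v"
      by (simp add: d_def distrib_right mult.assoc)
    also have "\<dots> = (?S ^^ N) (\<lambda>v. (k + 1) * ?y v + ?e v) v" by (simp only: kernel_op_pow_linear)
    also have "\<dots> \<le> (?S ^^ N) ((?S ^^ 1) ?y) v"
      by (rule mono) (use s step \<open>k \<ge> 0\<close> v in auto)
    finally show ?thesis by (simp add: funpow_swap1)
  qed
  have d0: "d > 0" using \<open>k \<ge> 0\<close> unfolding d_def by (intro add_nonneg_pos) auto
  \<comment> \<open>The growth rate per single step; it exceeds \<open>k + 1\<close> strictly, and
    undoing the shift by the identity costs 1.\<close>
  define c where "c = root (Suc N) d"
  have c0: "c \<ge> 0" using d0 by (simp add: c_def)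
  have c: "c ^ Suc N = d" unfolding c_def using d0 by (intro real_root_pow_pos2) auto
  have "c \<le> spectral_radius (kernel_mat vs ?s)"
  proof (rule spectral_radius_ge_growth[OF vs ne _ c0, where K = 1 and f = ?y])
    fix p
    have "1 * c ^ (Suc N * p) = d ^ p * ?y u" using C(2) by (simp only: power_mult c) simp
    also have "\<dots> \<le> (?S ^^ (Suc N * p)) ?y u"
      by (rule kernel_op_pow_supereigen[OF s]) (use d d0 u in auto)
    also have "\<dots> \<le> (\<Sum>v\<in>?V. (?S ^^ (Suc N * p)) ?y v)"
    proof (rule member_le_sum[OF u])
      fix v assume "v \<in> ?V - {u}"
      then show "0 \<le> (?S ^^ (Suc N * p)) ?y v" by (intro nonneg[of "?y" "?y"]) (use s in auto)
    qed simp
    finally show "\<exists>m\<ge>p. 1 * c ^ m \<le> (\<Sum>v\<in>?V. (?S ^^ m) ?y v)"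
      by (intro exI[of _ "Suc N * p"]) simp
  qed simp
  also have "\<dots> \<le> spectral_radius (kernel_mat vs a) + 1"
    by (rule spectral_radius_kernel_mat_shift[OF vs ne])
  finally have "c \<le> spectral_radius (kernel_mat vs a) + 1" .
  moreover have "k + 1 < c"
    by (rule power_less_imp_less_base[of _ "Suc N"]) (use c c0 in \<open>simp_all add: d_def\<close>)
  ultimately show ?thesis by simp
qed

section \<open>Cycles and bidirected arcs of a digraph\<close>

text \<open>Cutting a cycle at the arc leaves two walks that join at the base point to a walk from
  \<open>v\<close> to \<open>u\<close>. Conversely a simple path from \<open>v\<close> to
  \<open>u\<close>, empty for a loop, closes up with the arc.\<close>

lemma on_cycle_iff:
  assumes "pair_fin_digraph D"
  shows "on_cycle D (u, v) \<longleftrightarrow> (u, v) \<in> parcs D \<and> (v, u) \<in> (parcs D)\<^sup>*"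
proof -
  interpret pair_fin_digraph D by fact
  have rtrancl: "x \<rightarrow>\<^sup>*\<^bsub>with_proj D\<^esub> y \<Longrightarrow> (x, y) \<in> (parcs D)\<^sup>*" for x y
    by (simp add: reachable_def rtrancl_on_rtranclI)
  \<comment> \<open>Library reachability is reflexive only at vertices, hence the condition on the
    end point.\<close>
  have reachable: "x \<rightarrow>\<^sup>*\<^bsub>with_proj D\<^esub> y" if "(x, y) \<in> (parcs D)\<^sup>*" "y \<in> pverts D" for x y
    using that
  proof (induction rule: converse_rtrancl_induct)
    case (step x z)
    then show ?case by (intro adj_reachable_trans[of x z y]) auto
  qed auto
  show ?thesis
  proof
    assume "on_cycle D (u, v)"
    then obtain p x where p: "awalk x p x" "(u, v) \<in> set p"
      unfolding on_cycle_def cycle_def by blast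
    then obtain q r where "p = q @ (u, v) # r" by (meson split_list)
    with p(1) have "awalk x q u" "(u, v) \<in> parcs D" "awalk v r x"
      by (auto simp: awalk_Cons_iff)
    then show "(u, v) \<in> parcs D \<and> (v, u) \<in> (parcs D)\<^sup>*"
      by (meson reachable_awalkI rtrancl rtrancl_trans)
  next
    assume uv: "(u, v) \<in> parcs D \<and> (v, u) \<in> (parcs D)\<^sup>*"
    then have "v \<rightarrow>\<^sup>*\<^bsub>with_proj D\<^esub> u" using reachable in_arcsD1 by blast
    then obtain p where p: "apath v p u" by (auto simp: reachable_apath)
    have "awalk u ((u, v) # p) u" using p uv by (simp add: awalk_Cons_iff apath_def)
    moreover have "distinct (tl (pawalk_verts u ((u, v) # p)))" using p by (simp add: apath_def)
    ultimately have "cycle ((u, v) # p)" unfolding cycle_def by blast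
    then show "on_cycle D (u, v)" unfolding on_cycle_def by (intro exI[of _ "(u, v) # p"]) simp
  qed
qed

lemma adj_matrix_conv_kernel_mat:
  "adj_matrix D vs = kernel_mat vs (\<lambda>v w. of_bool ((v, w) \<in> parcs D))"
  unfolding adj_matrix_def kernel_mat_def by (intro cong_mat) auto

text \<open>Off-diagonal entries of the symmetric part are counted by \<open>c2\<close> and diagonal
  ones by the loops; hence \<open>(c2 + \<sigma>) / n\<close> is its average row sum.\<close>

lemma sum_bidirected_arcs:
  assumes "pair_fin_digraph D"
  shows "(\<Sum>v\<in>pverts D. \<Sum>w\<in>pverts D. of_bool ((v, w) \<in> parcs D \<and> (w, v) \<in> parcs D))
    = real (c2 D + card (loop_verts D))"
proof -
  interpret pair_fin_digraph D by fact
  let ?P = "{(v, w). v \<noteq> w \<and> (v, w) \<in> parcs D \<and> (w, v) \<in> parcs D}"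
  let ?L = "(\<lambda>v. (v, v)) ` loop_verts D"
  let ?B = "{(v, w). (v, w) \<in> parcs D \<and> (w, v) \<in> parcs D}"
  have B: "?B = ?P \<union> ?L" by (auto simp: loop_verts_def in_arcsD1)
  have finite: "finite ?P" "finite ?L"
    using pair_finite_arcs pair_finite_verts by (auto intro: finite_subset simp: loop_verts_def)
  have "(\<Sum>v\<in>pverts D. \<Sum>w\<in>pverts D. of_bool ((v, w) \<in> parcs D \<and> (w, v) \<in> parcs D))
    = (\<Sum>e\<in>pverts D \<times> pverts D. of_bool (e \<in> ?B) :: real)"
    unfolding sum.cartesian_product by (intro sum.cong) auto
  also have "\<dots> = real (card ((pverts D \<times> pverts D) \<inter> ?B))"
    using pair_finite_verts by (subst sum_of_bool_eq) auto
  also have "(pverts D \<times> pverts D) \<inter> ?B = ?P \<union> ?L"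
    unfolding B[symmetric] by (auto simp: in_arcsD1)
  also have "card (?P \<union> ?L) = card ?P + card ?L"
    using finite by (intro card_Un_disjoint) auto
  also have "card ?L = card (loop_verts D)" by (intro card_image inj_onI) auto
  finally show ?thesis by (simp add: c2_def)
qed

text \<open>
  The support of an eigenvector meets a strongly connected component from which no other component
  meeting the support is reachable. On it the eigenvector equation only involves bidirected arcs.
\<close>

lemma spectral_radius_le_bidirected_cycles:
  assumes "pair_fin_digraph D" and vs: "distinct vs" "vs \<noteq> []" "set vs = pverts D"
    and bidir: "\<And>v w. (v, w) \<in> parcs D \<Longrightarrow> (w, v) \<in> (parcs D)\<^sup>* \<Longrightarrow> (w, v) \<in> parcs D"
    and rows: "\<And>v. v \<in> pverts D \<Longrightarrow>
      (\<Sum>w\<in>pverts D. of_bool ((v, w) \<in> parcs D \<and> (w, v) \<in> parcs D)) \<le> k"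
  shows "spectral_radius (adj_matrix D vs) \<le> k"
proof -
  interpret pair_fin_digraph D by fact
  let ?V = "pverts D" and ?R = "(parcs D)\<^sup>*"
  let ?b = "\<lambda>v w. (v, w) \<in> parcs D \<and> (w, v) \<in> parcs D"
  obtain \<mu> where \<mu>: "eigenvalue (adj_matrix D vs) \<mu>" "norm \<mu> = spectral_radius (adj_matrix D vs)"
    unfolding adj_matrix_conv_kernel_mat using spectral_radius_kernel_mat_attained[OF vs(2)] .
  obtain x u where u: "u \<in> ?V" "x u \<noteq> 0"
    and x: "\<And>v. v \<in> ?V \<Longrightarrow> (\<Sum>w\<in>?V. complex_of_real (of_bool ((v, w) \<in> parcs D)) * x w) = \<mu> * x v"
    using \<mu>(1) unfolding adj_matrix_conv_kernel_mat eigenvalue_kernel_mat_iff[OF vs(1)] vs(3) by blast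
  define U where "U = {v \<in> ?V. x v \<noteq> 0}"
  define F where "F v = {w \<in> U. (v, w) \<in> ?R}" for v
  have U: "finite U" "U \<noteq> {}" "\<And>v. finite (F v)"
    using u pair_finite_verts by (auto simp: U_def F_def)
  \<comment> \<open>A support vertex reaching the fewest support vertices: whatever it reaches in
    the support must reach the same set, in particular \<open>v\<close> itself.\<close>
  obtain v where v: "v \<in> U" "\<And>w. w \<in> U \<Longrightarrow> card (F v) \<le> card (F w)"
    using ex_is_arg_min_if_finite[OF U(1,2), of "\<lambda>v. card (F v)"]
    by (auto simp: is_arg_min_linorder)
  have terminal: "(w, v) \<in> ?R" if w: "w \<in> U" "(v, w) \<in> ?R" for w
  proof -
    have "F w \<subseteq> F v" using w by (auto simp: F_def)
    from card_seteq[OF U(3) this v(2)[OF w(1)]] have "F w = F v" .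
    then show ?thesis using v(1) by (auto simp: F_def)
  qed
  define C where "C = {w \<in> ?V. (v, w) \<in> ?R \<and> (w, v) \<in> ?R}"
  have vC: "v \<in> C" using v(1) by (simp add: C_def U_def)
  have "finite C" "C \<noteq> {}" using vC pair_finite_verts by (auto simp: C_def)
  \<comment> \<open>The eigenvector equation is estimated at a vertex of largest modulus within
    \<open>C\<close>.\<close>
  then obtain i where i: "i \<in> C" "\<And>w. w \<in> C \<Longrightarrow> norm (x w) \<le> norm (x i)"
    using ex_is_arg_min_if_finite[of C "\<lambda>w. - norm (x w)"] by (auto simp: is_arg_min_linorder)
  have iV: "i \<in> ?V" using i(1) by (simp add: C_def)
  have xi: "norm (x i) > 0" using i(2)[OF vC] v(1) by (auto simp: U_def)
  have "\<mu> * x i = (\<Sum>w\<in>?V. of_bool (?b i w) * x w)"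
    unfolding x[OF iV, symmetric]
  proof (intro sum.cong refl)
    fix w assume w: "w \<in> ?V"
    \<comment> \<open>If \<open>w\<close> were in the support, terminality would put the arc on a
      cycle, and \<open>bidir\<close> would supply its opposite.\<close>
    have "x w = 0" if iw: "(i, w) \<in> parcs D" "(w, i) \<notin> parcs D"
    proof (rule ccontr)
      assume "x w \<noteq> 0"
      then have "w \<in> U" using w by (simp add: U_def)
      moreover have "(v, w) \<in> ?R" using i(1) iw(1) by (auto simp: C_def)
      ultimately have "(w, v) \<in> ?R" by (rule terminal)
      then have "(w, i) \<in> ?R" using i(1) by (auto simp: C_def)
      with bidir iw show False by blast
    qed
    then show "complex_of_real (of_bool ((i, w) \<in> parcs D)) * x w = of_bool (?b i w) * x w" by auto
  qed
  then have "norm \<mu> * norm (x i) = norm (\<Sum>w\<in>?V. of_bool (?b i w) * x w)"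
    by (simp flip: norm_mult)
  also have "\<dots> \<le> (\<Sum>w\<in>?V. of_bool (?b i w) * norm (x i))"
  proof (rule sum_norm_le)
    fix w assume w: "w \<in> ?V"
    have "norm (x w) \<le> norm (x i)" if "?b i w"
      using that i(1) w by (intro i(2)) (auto simp: C_def intro: rtrancl.rtrancl_into_rtrancl converse_rtrancl_into_rtrancl)
    then show "norm (of_bool (?b i w) * x w) \<le> of_bool (?b i w) * norm (x i)" by auto
  qed
  also have "\<dots> = (\<Sum>w\<in>?V. of_bool (?b i w)) * norm (x i)" by (simp add: sum_distrib_right)
  also have "\<dots> \<le> k * norm (x i)" using rows[OF iV] by (intro mult_right_mono) auto
  finally show ?thesis using xi \<mu>(2) by simp
qed

section \<open>The lower bound and the extremal digraphs\<close>

text \<open>At \<open>m = 1\<close> the walk condition is an equality, since the entries of the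
  symmetric part sum to \<open>c2 + \<sigma>\<close>.\<close>

lemma bidirected_average_le_spectral_radius:
  assumes "pair_fin_digraph D" and vs: "distinct vs" "vs \<noteq> []" "set vs = pverts D"
  shows "real (c2 D + card (loop_verts D)) / real (card (pverts D)) \<le> spectral_radius (adj_matrix D vs)"
  unfolding adj_matrix_conv_kernel_mat
proof (rule spectral_radius_ge_symmetric_minorant[OF vs(1,2), where m = 1])
  let ?b = "\<lambda>v w. of_bool ((v, w) \<in> parcs D \<and> (w, v) \<in> parcs D) :: real"
  have "card (pverts D) > 0" using vs by (metis card_gt_0_iff finite_set set_empty)
  then show "(real (c2 D + card (loop_verts D)) / real (card (pverts D))) ^ 1 * real (card (set vs))
    \<le> (\<Sum>v\<in>set vs. (kernel_op (set vs) ?b ^^ 1) (\<lambda>_. 1) v)"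
    using sum_bidirected_arcs[OF assms(1)] unfolding vs(3) by (simp add: kernel_op_def)
qed auto

text \<open>Row sums are constant by vanishing variance. A one-way arc on a cycle would then create
  a surplus at its tail inside its strong component and push the spectral radius above
  \<open>k\<close>.\<close>

lemma bidirected_extremal:
  assumes "pair_fin_digraph D" and vs: "distinct vs" "vs \<noteq> []" "set vs = pverts D"
    and k: "k = real (c2 D + card (loop_verts D)) / real (card (pverts D))"
    and rho: "spectral_radius (adj_matrix D vs) \<le> k"
  shows "v \<in> pverts D \<Longrightarrow> (\<Sum>w\<in>pverts D. of_bool ((v, w) \<in> parcs D \<and> (w, v) \<in> parcs D)) = k"
    and "on_cycle D (u, w) \<Longrightarrow> (w, u) \<in> parcs D"
proof -
  interpret pair_fin_digraph D by fact
  let ?V = "pverts D" and ?R = "(parcs D)\<^sup>*"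
  let ?a = "\<lambda>v w. of_bool ((v, w) \<in> parcs D) :: real"
  let ?b = "\<lambda>v w. of_bool ((v, w) \<in> parcs D \<and> (w, v) \<in> parcs D) :: real"
  have n: "card ?V > 0" using vs by (metis card_gt_0_iff finite_set set_empty)
  have rows: "(\<Sum>w\<in>?V. ?b v w) = k" if "v \<in> ?V" for v
    unfolding vs(3)[symmetric]
  proof (rule symmetric_minorant_row_sums_const[OF vs(1,2), where a = ?a])
    show "(\<Sum>v\<in>set vs. \<Sum>w\<in>set vs. ?b v w) = k * real (card (set vs))"
      unfolding vs(3) sum_bidirected_arcs[OF assms(1)] using n by (auto simp: k card_gt_0_iff)
    show "spectral_radius (kernel_mat vs ?a) \<le> k"
      using rho by (simp add: adj_matrix_conv_kernel_mat)
  qed (use that vs(3) in auto)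
  then show "v \<in> ?V \<Longrightarrow> (\<Sum>w\<in>?V. ?b v w) = k" .
  assume "on_cycle D (u, w)"
  then have uw: "(u, w) \<in> parcs D" "(w, u) \<in> ?R" using on_cycle_iff[OF assms(1)] by auto
  show "(w, u) \<in> parcs D"
  proof (rule ccontr)
    assume nwu: "(w, u) \<notin> parcs D"
    define C where "C = {z \<in> ?V. (u, z) \<in> ?R \<and> (z, u) \<in> ?R}"
    have CV: "C \<subseteq> ?V" and uC: "u \<in> C" and wC: "w \<in> C"
      using uw in_arcsD1 in_arcsD2 by (auto simp: C_def)
    have finC: "finite C" using CV pair_finite_verts finite_subset by blast
    \<comment> \<open>Bidirected neighbours stay in the component, so restricting the sum to
      \<open>C\<close> loses nothing.\<close>
    have row_b: "(\<Sum>z\<in>C. ?b v z) = k" if v: "v \<in> C" for v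
    proof -
      have "(\<Sum>z\<in>C. ?b v z) = (\<Sum>z\<in>?V. ?b v z)"
        using v CV by (intro sum.mono_neutral_left pair_finite_verts)
          (auto simp: C_def intro: rtrancl.rtrancl_into_rtrancl converse_rtrancl_into_rtrancl)
      then show ?thesis using rows v CV by auto
    qed
    have "k < spectral_radius (kernel_mat vs ?a)"
    proof (rule spectral_radius_gt_strongly_connected[OF vs(1)])
      show "C \<subseteq> set vs" using CV vs(3) by simp
      show "0 \<le> k" by (simp add: k)
      show "k \<le> (\<Sum>z\<in>C. ?a v z)" if "v \<in> C" for v
        unfolding row_b[OF that, symmetric] by (intro sum_mono) auto
      \<comment> \<open>The arc to \<open>w\<close> counts in \<open>?a\<close> but not in
        \<open>?b\<close>; this is the surplus 1.\<close>
      have "(\<Sum>z\<in>C. ?b u z + of_bool (z = w)) \<le> (\<Sum>z\<in>C. ?a u z)"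
        using uw nwu by (intro sum_mono) auto
      then show "k + 1 \<le> (\<Sum>z\<in>C. ?a u z)"
        using row_b[OF uC] wC finC by (simp add: sum.distrib of_bool_def)
      show "(v, u) \<in> {(y, z). y \<in> set vs \<and> z \<in> set vs \<and> 1 \<le> ?a y z}\<^sup>*" if "v \<in> C" for v
      proof -
        have "{(y, z). y \<in> set vs \<and> z \<in> set vs \<and> 1 \<le> ?a y z} = parcs D"
          using in_arcsD1 in_arcsD2 by (auto simp: vs(3))
        then show ?thesis using that by (simp add: C_def)
      qed
    qed (use uC in auto)
    then show False using rho by (simp add: adj_matrix_conv_kernel_mat)
  qed
qed

section \<open>Graphs with self-loops and the case of equality\<close>

lemma loop_graph_adj_of_bool:
  "loop_graph_adj G v w = of_bool ((v, w) \<in> parcs (symmetrization G))"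
  by (auto simp: symmetrization_def loop_graph_adj_def)

text \<open>The second unit a loop adds to the degree cancels the \<open>+ 1\<close> prescribed at
  loop vertices, leaving a condition on row sums.\<close>

lemma loop_graph_deg_eq_iff:
  assumes "lverts G = V" and "\<And>w. (v, w) \<in> parcs (symmetrization G) \<longleftrightarrow> P w"
  shows "real (loop_graph_deg G v) = (if v \<in> lloops G then k + 1 else k)
    \<longleftrightarrow> (\<Sum>w\<in>V. of_bool (P w)) = k"
  by (auto simp: loop_graph_deg_def loop_graph_adj_of_bool assms)

text \<open>Arcs on cycles, among them all loops and opposite pairs, avoid \<open>X\<close>, so they
  come from the symmetrization, which contains every arc with its opposite.\<close>

lemma symmetrization_plus_acyclic_arcs_bidirected:
  assumes fin: "pair_fin_digraph D"
    and D: "D = plus_arcs (symmetrization G) X" and X: "\<forall>e\<in>X. \<not> on_cycle D e"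
  shows "(v, w) \<in> parcs (symmetrization G) \<longleftrightarrow> (v, w) \<in> parcs D \<and> (w, v) \<in> parcs D"
    and "(v, w) \<in> parcs D \<Longrightarrow> (w, v) \<in> (parcs D)\<^sup>* \<Longrightarrow> (w, v) \<in> parcs D"
proof -
  have sym: "(w, v) \<in> parcs (symmetrization G)" if "(v, w) \<in> parcs (symmetrization G)" for v w
    using that by (auto simp: symmetrization_def insert_commute)
  have parcs: "parcs D = parcs (symmetrization G) \<union> X" by (subst D) (simp add: plus_arcs_def)
  have cyc: "(v, w) \<in> parcs (symmetrization G)" if "(v, w) \<in> parcs D" "(w, v) \<in> (parcs D)\<^sup>*" for v w
    using that X on_cycle_iff[OF fin] parcs by auto
  then show "(v, w) \<in> parcs (symmetrization G) \<longleftrightarrow> (v, w) \<in> parcs D \<and> (w, v) \<in> parcs D"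
    using sym parcs by blast
  show "(v, w) \<in> parcs D \<Longrightarrow> (w, v) \<in> (parcs D)\<^sup>* \<Longrightarrow> (w, v) \<in> parcs D"
    using sym cyc parcs by blast
qed

theorem lemma5p4:
  fixes D :: "'a pair_pre_digraph" and vs :: "'a list" and n \<sigma> :: nat and A :: "complex mat"
  assumes "pair_fin_digraph D" and "pverts D \<noteq> {}"
    and "distinct vs" and "set vs = pverts D"
  defines "n \<equiv> card (pverts D)" and "\<sigma> \<equiv> card (loop_verts D)" and "A \<equiv> adj_matrix D vs"
  shows "spectral_radius A \<ge> real (c2 D + \<sigma>) / real n \<and>
    (spectral_radius A = real (c2 D + \<sigma>) / real n \<longleftrightarrow>
      (\<exists>(G :: 'a loop_graph) X. wf_loop_graph G \<and>
         D = plus_arcs (symmetrization G) X \<and> (\<forall>e\<in>X. \<not> on_cycle D e) \<and>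
         bidegreed (real (c2 D + \<sigma>) / real n) (real (c2 D + \<sigma>) / real n + 1) G \<and>
         (\<forall>v\<in>lverts G. real (loop_graph_deg G v) =
            (if v \<in> lloops G then real (c2 D + \<sigma>) / real n + 1
             else real (c2 D + \<sigma>) / real n))))"
proof -
  interpret pair_fin_digraph D by fact
  define k where "k = real (c2 D + \<sigma>) / real n"
  let ?b = "\<lambda>v w. (v, w) \<in> parcs D \<and> (w, v) \<in> parcs D"
  have ne: "vs \<noteq> []" using assms(2,4) by auto
  have lower: "k \<le> spectral_radius A"
    unfolding k_def n_def \<sigma>_def A_def
    by (rule bidirected_average_le_spectral_radius[OF assms(1,3) ne assms(4)])
  have "\<exists>G X. wf_loop_graph G \<and> D = plus_arcs (symmetrization G) X \<and>
      (\<forall>e\<in>X. \<not> on_cycle D e) \<and> bidegreed k (k + 1) G \<and>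
      (\<forall>v\<in>lverts G. real (loop_graph_deg G v) = (if v \<in> lloops G then k + 1 else k))"
    if rho: "spectral_radius A = k"
  proof -
    \<comment> \<open>The only possible choice: \<open>G\<close> keeps the opposite pairs and the
      loops, and \<open>X\<close> collects the one-way arcs.\<close>
    define G where "G = \<lparr>lverts = pverts D, ledges = {{v, w} | v w. v \<noteq> w \<and> ?b v w},
      lloops = loop_verts D\<rparr>"
    define X where "X = parcs D - parcs (symmetrization G)"
    have sym: "(v, w) \<in> parcs (symmetrization G) \<longleftrightarrow> ?b v w" for v w
      by (auto simp: symmetrization_def G_def loop_verts_def in_arcsD1 doubleton_eq_iff)
    note ext = bidirected_extremal[OF assms(1,3) ne assms(4) k_def[unfolded n_def \<sigma>_def]
        eq_refl[OF rho[unfolded A_def]]]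
    have "wf_loop_graph G"
      using pair_finite_verts in_arcsD1 in_arcsD2
      by (auto simp: wf_loop_graph_def G_def loop_verts_def)
    moreover have "D = plus_arcs (symmetrization G) X"
    proof -
      have "pverts (symmetrization G) = pverts D" by (simp add: symmetrization_def G_def)
      moreover have "parcs (symmetrization G) \<union> X = parcs D" using sym by (auto simp: X_def)
      ultimately show ?thesis by (simp add: plus_arcs_def)
    qed
    moreover have "\<not> on_cycle D e" if "e \<in> X" for e
    proof
      assume cyc: "on_cycle D e"
      obtain v w where e: "e = (v, w)" by (cases e)
      show False using that ext(2) cyc sym unfolding e X_def by blast
    qed
    moreover have deg: "real (loop_graph_deg G v) = (if v \<in> lloops G then k + 1 else k)"
      if "v \<in> lverts G" for v
      using ext(1)[of v] that loop_graph_deg_eq_iff[of G "pverts D" v "?b v" k] sym by (simp add: G_def)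
    moreover have "bidegreed k (k + 1) G" using deg by (auto simp: bidegreed_def)
    ultimately show ?thesis by blast
  qed
  \<comment> \<open>Conversely, the description makes all arcs on cycles bidirected and the row sums
    of the symmetric part equal to \<open>k\<close>, which bounds every eigenvalue.\<close>
  moreover have "spectral_radius A = k"
    if G: "wf_loop_graph G" "D = plus_arcs (symmetrization G) X" "\<forall>e\<in>X. \<not> on_cycle D e"
      and deg: "\<forall>v\<in>lverts G. real (loop_graph_deg G v) = (if v \<in> lloops G then k + 1 else k)"
    for G :: "'a loop_graph" and X
  proof (rule antisym)
    note bidir = symmetrization_plus_acyclic_arcs_bidirected[OF assms(1) G(2,3)]
    have V: "lverts G = pverts D" by (subst G(2)) (simp add: plus_arcs_def symmetrization_def)
    show "spectral_radius A \<le> k"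
      unfolding A_def
    proof (rule spectral_radius_le_bidirected_cycles[OF assms(1,3) ne assms(4) bidir(2)])
      fix v assume "v \<in> pverts D"
      then show "(\<Sum>w\<in>pverts D. of_bool (?b v w)) \<le> k"
        using loop_graph_deg_eq_iff[OF V bidir(1), of v k] deg V by simp
    qed
  qed (rule lower)
  ultimately show ?thesis using lower unfolding k_def by blast
qed

end
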